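(* Let $p>0$. There are polynomials $P_m^p(y)$ (for real $m\ge 1$) and $Q_m^p(y)$ (for real $m\ge 0$), of degree $\lfloor m\rfloor$, such that for all real $m\ge 1$ and all $x>0$, $$V_m^p(x)=P_m^p(x^p)\,V_{m-\lfloor m\rfloor}^p(x)+x^p\,Q_{m-1}^p(x^p)\,V_{m-\lfloor m\rfloor-1}^p(x).$$
   Context: For real $p>0$, real $m>-1$ and $x>0$, $V_m^p(x)=\frac{p e^{x^p}}{\Gamma(m+1)}\int_x^\infty (t^p-x^p)^m e^{-t^p}\,dt=\frac{1}{\Gamma(m+1)}\int_0^\infty \frac{u^m e^{-u}}{(x^p+u)^{(p-1)/p}}\,du$. By convention $V_{-1}^p(x)=x^{1-p}$. $\lfloor m\rfloor$ is the largest integer less than or equal to $m$. *)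

theory Defs
  imports "HOL-Analysis.Analysis" "HOL-Computational_Algebra.Polynomial"
begin

text \<open>
  The function \<open>V\<^sub>m\<^sup>p(x)\<close>, written \<open>V p m x\<close>, is meant for \<open>p > 0\<close>, \<open>m \<ge> -1\<close> and \<open>x > 0\<close>;
  its values elsewhere are irrelevant. For \<open>m > -1\<close> the integrand is nonnegative and
  integrable on \<open>(x, \<infinity>)\<close>; the value at \<open>m = -1\<close> is a separate convention.
\<close>

definition V :: "real \<Rightarrow> real \<Rightarrow> real \<Rightarrow> real" where
  "V p m x =
    (if m = -1 then x powr (1 - p)
     else p * exp (x powr p) / Gamma (m + 1) *
       (LBINT t:{x<..}. (t powr p - x powr p) powr m * exp (- (t powr p))))"

end

theory Submission
  imports Defs "HOL-Real_Asymp.Real_Asymp"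
begin

text \<open>
  The theorem rests on a three-term recurrence in the order. Write \<open>y = x powr p\<close>. For \<open>m \<ge> 0\<close>,
  \<open>(m + 1) V\<^sub>m\<^sub>+\<^sub>1 = (m + 1 / p - y) V\<^sub>m + y V\<^sub>m\<^sub>-\<^sub>1\<close>.
  It comes from integrating the derivative of \<open>t (t powr p - y) powr m exp (- (t powr p))\<close> over
  \<open>(x, \<infinity>)\<close>: replacing each \<open>t powr p\<close> outside the exponential by \<open>(t powr p - y) + y\<close> turns this
  derivative into a combination of the integrands of orders \<open>m + 1\<close>, \<open>m\<close> and \<open>m - 1\<close>. For \<open>m > 0\<close>
  the boundary terms vanish. For \<open>m = 0\<close> the lower boundary term \<open>x exp (- y)\<close> survives while the
  integral of order \<open>-1\<close> has coefficient \<open>0\<close>, and the convention for \<open>V\<^sub>-\<^sub>1\<close> is exactly what makes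
  the boundary term take its place (\<open>V_recurrence\<close>).

  Starting from \<open>V\<^sub>f\<close> and \<open>V\<^sub>f\<^sub>-\<^sub>1\<close>, where \<open>f\<close> is the fractional part of \<open>m\<close>, the recurrence expresses
  \<open>V\<^sub>m\<close> as a combination of these two with polynomial coefficients in \<open>y\<close>. Up to a positive
  constant, each step multiplies the latest coefficient by \<open>- y\<close> to leading order and the one
  before, whose degree is smaller by one, by \<open>y\<close>; so the degree grows by exactly one. The coefficients of \<open>V\<^sub>f\<^sub>-\<^sub>1\<close> satisfy the same recurrence as
  those of \<open>V\<^sub>f\<close> with \<open>f\<close> replaced by \<open>f + 1\<close>, up to the factor \<open>y / (f + 1)\<close>; hence the single
  family \<open>V_poly\<close> provides both \<open>P\<close> and \<open>Q\<close>.
\<close>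

section \<open>The integral\<close>

lemma tendsto_powr_diff_powr_at_right:
  fixes p r x :: real
  assumes "p > 0" "r > 0" "x > 0"
  shows "((\<lambda>t. (t powr p - x powr p) powr r) \<longlongrightarrow> 0) (at_right x)"
proof -
  have "\<forall>\<^sub>F t in at_right x. t powr p - x powr p \<ge> 0"
    using assms by (intro eventually_at_rightI[of x "x + 1"]) (auto intro!: powr_mono2)
  moreover have "((\<lambda>t. t powr p - x powr p) \<longlongrightarrow> x powr p - x powr p) (at_right x)"
    using assms by (intro tendsto_intros) auto
  ultimately have "((\<lambda>t. (t powr p - x powr p) powr r) \<longlongrightarrow> (x powr p - x powr p) powr r) (at_right x)"
    using assms by (intro tendsto_powr') auto
  thus ?thesis by simp
qed

text \<open>
  With \<open>D t = t powr p - x powr p\<close>, the function \<open>- 1 / (1 + D t powr (m + 1))\<close> is increasing and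
  bounded on \<open>(x, \<infinity>)\<close>, so its derivative is integrable. This derivative has the same singularity
  \<open>D t powr m\<close> at \<open>x\<close> and decays only like a power of \<open>t\<close> at infinity, so a multiple of it dominates
  the integrand. This treats the endpoint singularity for \<open>m < 0\<close> and the infinite range at once.
\<close>
lemma powr_diff_powr_exp_integrable:
  fixes p m x :: real
  assumes "p > 0" "m > -1" "x > 0"
  shows "set_integrable lborel {x<..} (\<lambda>t. (t powr p - x powr p) powr m * exp (- (t powr p)))"
proof -
  (* Naming this constant presents it to real_asymp as an atom. *)
  define y where "y = x powr p"
  define D where "D = (\<lambda>t::real. t powr p - y)"
  define h where "h = (\<lambda>t. (m + 1) * D t powr m * (p * t powr (p - 1)) / (1 + D t powr (m + 1))\<^sup>2)"
  define H where "H = (\<lambda>t. - 1 / (1 + D t powr (m + 1)))"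
  define g where "g = (\<lambda>t. exp (- (t powr p)) * t powr (1 - p) * (1 + D t powr (m + 1))\<^sup>2)"
  have D_pos: "D t > 0" if "t > x" for t
    using that assms by (simp add: D_def y_def powr_less_mono2)
  have D_nonneg: "D t \<ge> 0" if "t \<ge> x" for t
    using that assms by (simp add: D_def y_def powr_mono2)
  have nz: "1 + D t powr (m + 1) > 0" for t
    by (simp add: add_pos_nonneg)
  have h_integrable: "set_integrable lborel (einterval x \<infinity>) h"
  proof (rule interval_integral_FTC_nonneg(1))
    fix t assume "ereal x < ereal t"
    hence t: "t > x" by simp
    hence "D t > 0" "t > 0" using D_pos assms by auto
    moreover have "1 + D t powr (m + 1) \<noteq> 0"
      using nz[of t] by linarith
    ultimately show "DERIV H t :> h t"
      unfolding H_def h_def D_def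
      by (auto intro!: derivative_eq_intros simp: power2_eq_square)
    show "isCont h t"
      using \<open>D t > 0\<close> \<open>t > 0\<close> \<open>1 + D t powr (m + 1) \<noteq> 0\<close> unfolding h_def D_def
      by (auto intro!: continuous_intros)
  next
    show "AE t in lborel. ereal x < ereal t \<longrightarrow> ereal t < \<infinity> \<longrightarrow> 0 \<le> h t"
      using assms by (auto simp: h_def)
  next
    have "((\<lambda>t. - 1 / (1 + D t powr (m + 1))) \<longlongrightarrow> - 1 / (1 + 0)) (at_right x)"
      unfolding D_def y_def using assms
      by (intro tendsto_intros tendsto_powr_diff_powr_at_right) auto
    hence "(H \<longlongrightarrow> - 1) (at_right x)"
      by (simp add: H_def)
    thus "((H \<circ> real_of_ereal) \<longlongrightarrow> - 1) (at_right (ereal x))"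
      by (simp add: ereal_tendsto_simps)
  next
    have "(H \<longlongrightarrow> 0) at_top"
      using assms unfolding H_def D_def by real_asymp
    thus "((H \<circ> real_of_ereal) \<longlongrightarrow> 0) (at_left \<infinity>)"
      by (simp add: ereal_tendsto_simps)
  qed simp
  (* g is, up to the constant (m + 1) * p, the quotient of the integrand by h; it is continuous up to
     the endpoint x, where the singular powers of D cancel, and it vanishes at infinity. *)
  obtain C where C: "\<And>t. t \<ge> x \<Longrightarrow> g t \<le> C"
  proof -
    have "(g \<longlongrightarrow> 0) at_top"
      using assms unfolding g_def D_def by real_asymp
    hence "\<forall>\<^sub>F t in at_top. g t < 1"
      by (rule order_tendstoD) simp
    then obtain X where X: "\<And>t. t \<ge> X \<Longrightarrow> g t < 1"
      by (auto simp: eventually_at_top_linorder)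
    have "continuous_on {x..X} g"
      using assms D_nonneg unfolding g_def D_def
      by (intro continuous_intros continuous_on_powr') auto
    hence "bounded (g ` {x..X})"
      by (intro compact_imp_bounded compact_continuous_image) auto
    then obtain B where B: "\<forall>t\<in>{x..X}. \<bar>g t\<bar> \<le> B"
      unfolding bounded_iff by auto
    show ?thesis
    proof (rule that)
      fix t assume "t \<ge> x"
      thus "g t \<le> max B 1"
        using X[of t] B by (cases "t \<ge> X") (auto simp: abs_le_iff le_max_iff_disj)
    qed
  qed
  have "set_integrable lborel {x<..} (\<lambda>t. C / ((m + 1) * p) * h t)"
    using h_integrable by (intro set_integrable_mult_right) auto
  thus ?thesis
  proof (rule set_integrable_bound)
    show "set_borel_measurable lborel {x<..}
            (\<lambda>t. (t powr p - x powr p) powr m * exp (- (t powr p)))"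
      unfolding set_borel_measurable_def by measurable
    have "norm ((t powr p - x powr p) powr m * exp (- (t powr p))) \<le> norm (C / ((m + 1) * p) * h t)"
      if "t > x" for t
    proof -
      have "t powr (1 - p) * t powr (p - 1) = 1"
        using that assms by (simp flip: powr_add)
      moreover have "g t * (h t / ((m + 1) * p)) =
          D t powr m * exp (- (t powr p)) * (t powr (1 - p) * t powr (p - 1))"
        using assms nz[of t] by (simp add: g_def h_def)
      ultimately have "norm ((t powr p - x powr p) powr m * exp (- (t powr p))) =
          g t * (h t / ((m + 1) * p))"
        by (simp add: D_def y_def abs_mult)
      also have "\<dots> \<le> C * (h t / ((m + 1) * p))"
        using C[of t] that assms by (intro mult_right_mono) (auto simp: h_def)
      also have "\<dots> = C / ((m + 1) * p) * h t"
        by simp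
      also have "\<dots> \<le> norm \<dots>"
        unfolding real_norm_def by (rule abs_ge_self)
      finally show ?thesis .
    qed
    thus "AE t in lborel. t \<in> {x<..} \<longrightarrow>
        norm ((t powr p - x powr p) powr m * exp (- (t powr p))) \<le> norm (C / ((m + 1) * p) * h t)"
      by (intro AE_I2) simp
  qed
qed

definition V_integral :: "real \<Rightarrow> real \<Rightarrow> real \<Rightarrow> real" where
  "V_integral p m x = (LBINT t:{x<..}. (t powr p - x powr p) powr m * exp (- (t powr p)))"

text \<open>
  This is the fundamental theorem of calculus for \<open>F t = t (t powr p - x powr p) powr m exp (- (t powr p))\<close>
  on \<open>(x, \<infinity>)\<close>. At \<open>m = 0\<close> the integral of order \<open>m - 1\<close> diverges, but its coefficient is then \<open>0\<close>;
  the last summand is the limit of \<open>F\<close> at \<open>x\<close>.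
\<close>
lemma V_integral_recurrence:
  fixes p m x :: real
  assumes "p > 0" "m \<ge> 0" "x > 0"
  shows "p * V_integral p (m + 1) x =
    (m * p + 1 - p * x powr p) * V_integral p m x + m * p * x powr p * V_integral p (m - 1) x
    + (if m = 0 then x * exp (- (x powr p)) else 0)"
proof -
  (* Naming this constant presents it to real_asymp as an atom. *)
  define y where "y = x powr p"
  define w where "w = (\<lambda>r t. (t powr p - x powr p) powr r * exp (- (t powr p)))"
  define F where "F = (\<lambda>t. t * w m t)"
  define a where "a = m * p + 1 - p * x powr p"
  define b where "b = m * p * x powr p"
  define f where "f = (\<lambda>t. a * w m t + b * w (m - 1) t - p * w (m + 1) t)"
  have int: "set_integrable lborel {x<..} (w r)" if "r > -1" for r
    unfolding w_def using assms that by (intro powr_diff_powr_exp_integrable) auto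
  have int_a: "set_integrable lborel {x<..} (\<lambda>t. a * w m t)"
    using assms by (intro set_integrable_mult_right int) auto
  have int_b: "set_integrable lborel {x<..} (\<lambda>t. b * w (m - 1) t)"
    using assms by (intro set_integrable_mult_right int) (auto simp: b_def)
  have int_c: "set_integrable lborel {x<..} (\<lambda>t. p * w (m + 1) t)"
    using assms by (intro set_integrable_mult_right int) auto
  have pos: "t powr p - x powr p > 0" if "t > x" for t
    using that assms by (simp add: powr_less_mono2)
  have "(LBINT t=ereal x..\<infinity>. f t) = 0 - (if m = 0 then x * exp (- (x powr p)) else 0)"
  proof (rule interval_integral_FTC_integrable)
    fix t assume "ereal x < ereal t"
    hence t: "t > x" "t > 0" using assms by auto
    define d where "d = t powr p - x powr p"
    define e where "e = exp (- (t powr p))"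
    have d: "d > 0" using pos t by (simp add: d_def)
    have "DERIV F t :> d powr m * e + t * (m * d powr (m - 1) * (p * t powr (p - 1)) * e
            + d powr m * (e * - (p * t powr (p - 1))))"
      unfolding F_def w_def d_def e_def using t d[unfolded d_def]
      by (auto intro!: derivative_eq_intros simp: algebra_simps)
    also have "d powr m * e + t * (m * d powr (m - 1) * (p * t powr (p - 1)) * e
            + d powr m * (e * - (p * t powr (p - 1)))) =
          d powr m * e + p * (t powr p) * (m * d powr (m - 1) - d powr m) * e"
      using t by (simp add: algebra_simps powr_diff)
    also have "\<dots> = f t"
    proof -
      have "d powr m = d * d powr (m - 1)" "d powr (m + 1) = d * d * d powr (m - 1)"
        using d by (simp_all add: powr_diff powr_add)
      moreover have "t powr p = d + x powr p" by (simp add: d_def)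
      ultimately show ?thesis
        unfolding f_def w_def a_def b_def d_def[symmetric] e_def[symmetric]
        by (simp add: algebra_simps)
    qed
    finally show "(F has_vector_derivative f t) (at t)"
      by (simp add: has_real_derivative_iff_has_vector_derivative)
    show "isCont f t"
      using d t unfolding f_def w_def d_def
      by (auto intro!: continuous_intros)
  next
    show "set_integrable lborel (einterval (ereal x) \<infinity>) f"
      unfolding f_def using int_a int_b int_c by auto
  next
    have "(F \<longlongrightarrow> 0) at_top"
      using assms unfolding F_def w_def y_def[symmetric] by real_asymp
    thus "((F \<circ> real_of_ereal) \<longlongrightarrow> 0) (at_left \<infinity>)"
      by (simp add: ereal_tendsto_simps)
  next
    have "((\<lambda>t. (t powr p - x powr p) powr m) \<longlongrightarrow> (if m = 0 then 1 else 0)) (at_right x)"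
    proof (cases "m = 0")
      case True
      have "\<forall>\<^sub>F t in at_right x. (t powr p - x powr p) powr m = 1"
        using pos True by (intro eventually_at_rightI[of x "x + 1"]) fastforce+
      thus ?thesis
        using True by (simp add: tendsto_eventually)
    next
      case False
      thus ?thesis
        using assms tendsto_powr_diff_powr_at_right[of p m x] by simp
    qed
    hence "(F \<longlongrightarrow> x * ((if m = 0 then 1 else 0) * exp (- (x powr p)))) (at_right x)"
      unfolding F_def w_def using assms by (intro tendsto_intros) auto
    thus "((F \<circ> real_of_ereal) \<longlongrightarrow> (if m = 0 then x * exp (- (x powr p)) else 0)) (at_right (ereal x))"
      by (simp add: ereal_tendsto_simps split: if_splits)
  qed simp
  moreover have "(LBINT t=ereal x..\<infinity>. f t) =
      a * V_integral p m x + b * V_integral p (m - 1) x - p * V_integral p (m + 1) x"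
    using int_a int_b int_c
    by (simp add: interval_integral_to_infinity_eq f_def V_integral_def w_def set_integral_add set_integral_diff)
  ultimately show ?thesis
    by (simp add: a_def b_def)
qed

section \<open>The recurrence\<close>

text \<open>
  Normalising by the Gamma function absorbs the factor \<open>m\<close> in front of the integral of order \<open>m - 1\<close>,
  because \<open>Gamma (m + 1) = m Gamma m\<close>. For \<open>m = 0\<close> the summand with \<open>V p (- 1) x\<close> is the boundary
  term instead: after multiplication by \<open>exp (x powr p)\<close> it is \<open>x = x powr p * x powr (1 - p)\<close>.
\<close>
lemma V_recurrence:
  fixes p m x :: real
  assumes "p > 0" "m \<ge> 0" "x > 0"
  shows "V p (m + 1) x = ((m + 1 / p - x powr p) * V p m x + x powr p * V p (m - 1) x) / (m + 1)"
proof -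
  define c where "c = exp (x powr p) / Gamma (m + 1)"
  have V_eq: "V p r x = p * exp (x powr p) / Gamma (r + 1) * V_integral p r x" if "r \<noteq> -1" for r
    using that by (simp add: V_def V_integral_def)
  have G: "Gamma (m + 1 + 1) = (m + 1) * Gamma (m + 1)" "Gamma (m + 1) > 0"
    using assms by (intro Gamma_plus1 Gamma_real_pos; force)+
  have V_m: "p * c * V_integral p m x = V p m x"
    using assms by (simp add: V_eq c_def)
  have V_Suc: "p * c * V_integral p (m + 1) x = (m + 1) * V p (m + 1) x"
    using assms G by (simp add: V_eq c_def add_ac)
  have V_pre: "m * p * x powr p * c * V_integral p (m - 1) x
      + c * (if m = 0 then x * exp (- (x powr p)) else 0) = x powr p * V p (m - 1) x"
  proof (cases "m = 0")
    case True
    have "exp (x powr p) * exp (- (x powr p)) = 1"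
      by (simp flip: exp_add)
    moreover have "x powr p * x powr (1 - p) = x"
      using assms by (simp flip: powr_add)
    ultimately show ?thesis
      using True by (simp add: V_def c_def)
  next
    case False
    hence "Gamma (m + 1) = m * Gamma m"
      using assms by (intro Gamma_plus1) auto
    thus ?thesis
      using False assms by (simp add: V_eq c_def)
  qed
  have "(m + 1) * V p (m + 1) x = c * (p * V_integral p (m + 1) x)"
    using V_Suc by (simp add: mult_ac)
  also have "\<dots> = (m + 1 / p - x powr p) * (p * c * V_integral p m x) +
      (m * p * x powr p * c * V_integral p (m - 1) x
        + c * (if m = 0 then x * exp (- (x powr p)) else 0))"
    unfolding V_integral_recurrence[OF assms] using assms by (simp add: field_simps)
  finally show ?thesis
    unfolding V_m V_pre using assms by (simp add: eq_divide_eq mult.commute)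
qed

section \<open>The polynomial coefficients\<close>

text \<open>
  \<open>V_poly p f n\<close> is the coefficient of \<open>V\<^sub>f\<close> in the expansion of \<open>V\<^sub>f\<^sub>+\<^sub>n\<close>, as a polynomial in \<open>x powr p\<close>.
\<close>
fun V_poly :: "real \<Rightarrow> real \<Rightarrow> nat \<Rightarrow> real poly" where
  "V_poly p f 0 = 1"
| "V_poly p f (Suc 0) = smult (1 / (f + 1)) [:f + 1 / p, -1:]"
| "V_poly p f (Suc (Suc n)) = smult (1 / (f + real n + 2))
     ([:f + real n + 1 + 1 / p, -1:] * V_poly p f (Suc n) + pCons 0 (V_poly p f n))"

lemma poly_V_poly_Suc_Suc:
  "poly (V_poly p f (Suc (Suc n))) y =
    ((f + real n + 1 + 1 / p - y) * poly (V_poly p f (Suc n)) y + y * poly (V_poly p f n) y)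
      / (f + real n + 2)"
  by (subst V_poly.simps(3)) (simp add: algebra_simps add_divide_distrib diff_divide_distrib
      del: V_poly.simps)

lemma degree_V_poly:
  assumes "f > -1"
  shows "degree (V_poly p f n) = n"
  using assms
proof (induction p f n rule: V_poly.induct)
  case (3 p f n)
  hence IH: "degree (V_poly p f n) = n" "degree (V_poly p f (Suc n)) = Suc n"
    by auto
  hence "degree ([:f + real n + 1 + 1 / p, -1:] * V_poly p f (Suc n)) = Suc (Suc n)"
    by (subst degree_mult_eq) auto
  moreover have "degree (pCons 0 (V_poly p f n)) < Suc (Suc n)"
    using degree_pCons_le[of 0 "V_poly p f n"] IH by simp
  ultimately have "degree ([:f + real n + 1 + 1 / p, -1:] * V_poly p f (Suc n)
      + pCons 0 (V_poly p f n)) = Suc (Suc n)"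
    by (subst degree_add_eq_left) auto
  thus ?case
    using 3 by simp
qed auto

lemma V_poly_nonzero:
  assumes "f > -1"
  shows "V_poly p f n \<noteq> 0"
proof (cases n)
  case (Suc k)
  thus ?thesis
    using degree_V_poly[OF assms, of p n] by auto
qed simp

text \<open>
  The coefficient of \<open>V\<^sub>f\<^sub>-\<^sub>1\<close> in the expansion of \<open>V\<^sub>f\<^sub>+\<^sub>n\<close> is \<open>0\<close> for \<open>n = 0\<close> and \<open>y / (f + 1)\<close> for
  \<open>n = 1\<close>, where \<open>y = x powr p\<close>. Divided by its value at \<open>n = 1\<close>, it has the initial values of the
  coefficient family of base order \<open>f + 1\<close>, at index \<open>n - 1\<close>, and it obeys the same recurrence.
\<close>
lemma V_add_nat:
  assumes "p > 0" "f \<ge> 0" "x > 0"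
  shows "V p (f + real (Suc n)) x =
    poly (V_poly p f (Suc n)) (x powr p) * V p f x
    + x powr p * (poly (V_poly p (f + 1) n) (x powr p) / (f + 1)) * V p (f - 1) x"
proof -
  define A where "A = f + 1 + 1 / p - x powr p"
  define q where "q = poly (V_poly p f 1) (x powr p)"
  have "q = (f + 1 / p - x powr p) / (f + 1)"
    by (simp add: q_def diff_divide_distrib add_divide_distrib)
  hence step1: "V p (f + 1) x = q * V p f x + x powr p / (f + 1) * V p (f - 1) x"
    using V_recurrence[OF assms] by (simp add: add_divide_distrib)
  have "V p (f + 2) x = (A * V p (f + 1) x + x powr p * V p f x) / (f + 2)"
    using V_recurrence[of p "f + 1" x] assms by (simp add: A_def add_ac)
  also have "\<dots> = (A * q + x powr p) / (f + 2) * V p f x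
      + x powr p * (A / (f + 2) / (f + 1)) * V p (f - 1) x"
    unfolding step1 by (simp add: add_divide_distrib ring_distribs mult_ac)
  finally have step2: "V p (f + 2) x = \<dots>" .
  show ?thesis
  proof (induction n rule: induct_nat_012)
    case 0
    show ?case
      using step1 by (simp add: q_def)
  next
    case 1
    have "poly (V_poly p f (Suc (Suc 0))) (x powr p) = (A * q + x powr p) / (f + 2)"
      by (simp add: A_def q_def poly_V_poly_Suc_Suc del: V_poly.simps(2,3))
    moreover have "poly (V_poly p (f + 1) (Suc 0)) (x powr p) = A / (f + 2)"
      by (simp add: A_def diff_divide_distrib add_divide_distrib add_ac)
    ultimately show ?case
      using step2 by (simp del: V_poly.simps)
  next
    case (ge2 n)
    define m where "m = f + real n + 2"
    define A where "A = m + 1 / p - x powr p"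
    have "V p (f + real (Suc (Suc (Suc n)))) x =
       (A * V p (f + real (Suc (Suc n))) x + x powr p * V p (f + real (Suc n)) x) / (m + 1)"
      using V_recurrence[of p m x] assms by (simp add: m_def A_def add_ac)
    moreover have "poly (V_poly p f (Suc (Suc (Suc n)))) (x powr p) =
       (A * poly (V_poly p f (Suc (Suc n))) (x powr p)
        + x powr p * poly (V_poly p f (Suc n)) (x powr p)) / (m + 1)"
      by (simp add: poly_V_poly_Suc_Suc m_def A_def add_ac del: V_poly.simps)
    moreover have "poly (V_poly p (f + 1) (Suc (Suc n))) (x powr p) =
       (A * poly (V_poly p (f + 1) (Suc n)) (x powr p)
        + x powr p * poly (V_poly p (f + 1) n) (x powr p)) / (m + 1)"
      by (simp add: poly_V_poly_Suc_Suc m_def A_def add_ac del: V_poly.simps)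
    ultimately show ?case
      unfolding ge2 by (simp add: algebra_simps add_divide_distrib del: V_poly.simps)
  qed
qed

theorem corollary12:
  fixes p :: real
  assumes "p > 0"
  shows "\<exists>P Q :: real \<Rightarrow> real poly.
    (\<forall>m\<ge>1. degree (P m) = nat \<lfloor>m\<rfloor>) \<and>
    (\<forall>m\<ge>0. Q m \<noteq> 0 \<and> degree (Q m) = nat \<lfloor>m\<rfloor>) \<and>
    (\<forall>m\<ge>1. \<forall>x>0.
      V p m x =
        poly (P m) (x powr p) * V p (m - of_int \<lfloor>m\<rfloor>) x +
        x powr p * poly (Q (m - 1)) (x powr p) * V p (m - of_int \<lfloor>m\<rfloor> - 1) x)"
proof (intro exI conjI allI impI)
  let ?P = "\<lambda>m. V_poly p (frac m) (nat \<lfloor>m\<rfloor>)"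
  let ?Q = "\<lambda>m. smult (1 / (frac m + 1)) (V_poly p (frac m + 1) (nat \<lfloor>m\<rfloor>))"
  have f: "frac m \<ge> 0" for m :: real by simp
  have f1: "frac m > -1" "frac m + 1 > -1" "frac m + 1 \<noteq> 0" for m :: real
    using f[of m] by linarith+
  show "degree (?P m) = nat \<lfloor>m\<rfloor>" for m
    using f1 by (intro degree_V_poly)
  show "?Q m \<noteq> 0" "degree (?Q m) = nat \<lfloor>m\<rfloor>" for m
    using f1 by (simp_all add: degree_V_poly V_poly_nonzero)
  fix m x :: real
  assume m: "m \<ge> 1" and x: "x > 0"
  define n where "n = nat \<lfloor>m - 1\<rfloor>"
  have n: "nat \<lfloor>m\<rfloor> = Suc n" "nat \<lfloor>m - 1\<rfloor> = n" "m = frac m + real (Suc n)"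
    using m by (auto simp: n_def frac_def nat_diff_distrib of_nat_diff)
  have "frac (m - 1) = frac m"
    by (simp add: frac_def)
  with V_add_nat[OF assms f x, of m n, folded n(3)] show "V p m x =
        poly (?P m) (x powr p) * V p (m - of_int \<lfloor>m\<rfloor>) x +
        x powr p * poly (?Q (m - 1)) (x powr p) * V p (m - of_int \<lfloor>m\<rfloor> - 1) x"
    by (simp add: n(1,2) del: V_poly.simps floor_diff_one flip: frac_def)
qed

end
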